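(* Let $n\ge 1$ and let $T:\mathbb{H}^n\rightrightarrows V_1$ be a maximal H-monotone map with $\mathrm{dom}(T)=\mathbb{H}^n$. Then $T$ is locally bounded if and only if $T$ is upper semicontinuous.
   Context: The Heisenberg group $\mathbb{H}^n$ is $\mathbb{R}^n\times\mathbb{R}^n\times\mathbb{R}$ with group law $(x,y,t)\circ(x',y',t')=(x+x',y+y',t+t'+2(\langle x',y\rangle-\langle x,y'\rangle))$ and metric $d_H(\eta,\eta')=N((\eta')^{-1}\circ\eta)$, where $N(x,y,t)=((\|x\|^2+\|y\|^2)^2+t^2)^{1/4}$ (it induces the Euclidean topology). $V_1\cong\mathbb{R}^{2n}$ is the first (horizontal) layer of its Lie algebra, with the Euclidean inner product $\langle\cdot,\cdot\rangle$ and norm, and $\xi_1:\mathbb{H}^n\to V_1$ is $\xi_1(x,y,t)=(x,y)$. For $\eta_0=(x_0,y_0,t_0)\in\mathbb{H}^n$ the horizontal plane through $\eta_0$ is $H_{\eta_0}=\{(x,y,t)\in\mathbb{H}^n: t=t_0+2(\langle y_0,x\rangle-\langle x_0,y\rangle)\}$. A set-valued map $T:\mathbb{H}^n\rightrightarrows V_1$ assigns to each $\eta$ a (possibly empty) subset $T(\eta)\subseteq V_1$; $\mathrm{dom}(T)=\{\eta: T(\eta)\ne\emptyset\}$ and $\mathrm{gr}(T)=\{(\eta,v): v\in T(\eta)\}$. A set $A\subset\mathbb{H}^n\times V_1$ is H-monotone if $\langle \xi_1(\eta)-\xi_1(\eta'),v-v'\rangle\ge 0$ for all $(\eta,v),(\eta',v')\in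 A$ with $\eta'\in H_\eta$; it is maximal H-monotone if it is H-monotone and is not properly contained in any H-monotone set. $T$ is (maximal) H-monotone if $\mathrm{gr}(T)$ is a (maximal) H-monotone set. $T$ is locally bounded if every point of $\mathbb{H}^n$ has a neighbourhood $U$ such that $T(U)=\bigcup_{\eta\in U}T(\eta)$ is bounded in $V_1$. $T$ is upper semicontinuous at $\eta$ if for every $\epsilon>0$ there is $\delta>0$ such that $T(\eta')\subseteq T(\eta)+B_{\mathbb{R}^{2n}}(0,\epsilon)$ (Minkowski sum) for all $\eta'\in\mathbb{H}^n$ with $d_H(\eta',\eta)<\delta$; $T$ is upper semicontinuous if it is so at every point. *)

theory Defs
  imports "HOL-Analysis.Analysis"
begin

text \<open>
  The dimension $n$ is \<open>CARD('n)\<close>, hence at least 1. The type \<open>'n heis\<close> is used as a topological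
  space with its product (that is, Euclidean) topology, which is the one induced by \<open>heis_dist\<close>.
  The inner product and norm of the product type \<open>'n horiz\<close> are the Euclidean ones.
\<close>

type_synonym 'n heis = "(real ^ 'n) \<times> (real ^ 'n) \<times> real"
type_synonym 'n horiz = "(real ^ 'n) \<times> (real ^ 'n)"

fun heis_mult :: "'n::finite heis \<Rightarrow> 'n heis \<Rightarrow> 'n heis" where
  "heis_mult (x, y, t) (x', y', t') =
     (x + x', y + y', t + t' + 2 * (x' \<bullet> y - x \<bullet> y'))"

fun heis_inv :: "'n::finite heis \<Rightarrow> 'n heis" where
  "heis_inv (x, y, t) = (- x, - y, - t)"

lemma heis_mult_inv:
  "heis_mult (heis_inv p) p = (0, 0, 0)" "heis_mult p (heis_inv p) = (0, 0, 0)"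
  by (cases p; simp add: inner_commute)+

fun heis_gauge :: "'n::finite heis \<Rightarrow> real" where
  "heis_gauge (x, y, t) = root 4 (((norm x)\<^sup>2 + (norm y)\<^sup>2)\<^sup>2 + t\<^sup>2)"

definition heis_dist :: "'n::finite heis \<Rightarrow> 'n heis \<Rightarrow> real" where
  "heis_dist p q = heis_gauge (heis_mult (heis_inv q) p)"

fun xi1 :: "'n::finite heis \<Rightarrow> 'n horiz" where
  "xi1 (x, y, t) = (x, y)"

fun hplane :: "'n::finite heis \<Rightarrow> 'n heis set" where
  "hplane (x0, y0, t0) = {(x, y, t). t = t0 + 2 * (y0 \<bullet> x - x0 \<bullet> y)}"

definition sv_dom :: "('n::finite heis \<Rightarrow> 'n horiz set) \<Rightarrow> 'n heis set" where
  "sv_dom T = {p. T p \<noteq> {}}"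

definition sv_graph :: "('n::finite heis \<Rightarrow> 'n horiz set) \<Rightarrow> ('n heis \<times> 'n horiz) set" where
  "sv_graph T = {(p, v). v \<in> T p}"

definition H_monotone_set :: "('n::finite heis \<times> 'n horiz) set \<Rightarrow> bool" where
  "H_monotone_set A \<longleftrightarrow>
     (\<forall>(p, v)\<in>A. \<forall>(p', v')\<in>A. p' \<in> hplane p \<longrightarrow> (xi1 p - xi1 p') \<bullet> (v - v') \<ge> 0)"

definition maximal_H_monotone_set :: "('n::finite heis \<times> 'n horiz) set \<Rightarrow> bool" where
  "maximal_H_monotone_set A \<longleftrightarrow> H_monotone_set A \<and> \<not> (\<exists>B. H_monotone_set B \<and> A \<subset> B)"

definition maximal_H_monotone :: "('n::finite heis \<Rightarrow> 'n horiz set) \<Rightarrow> bool" where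
  "maximal_H_monotone T \<longleftrightarrow> maximal_H_monotone_set (sv_graph T)"

definition sv_locally_bounded :: "('n::finite heis \<Rightarrow> 'n horiz set) \<Rightarrow> bool" where
  "sv_locally_bounded T \<longleftrightarrow> (\<forall>p. \<exists>U. open U \<and> p \<in> U \<and> bounded (\<Union>q\<in>U. T q))"

definition sv_usc_at :: "('n::finite heis \<Rightarrow> 'n horiz set) \<Rightarrow> 'n heis \<Rightarrow> bool" where
  "sv_usc_at T p \<longleftrightarrow>
     (\<forall>\<epsilon>>0. \<exists>\<delta>>0. \<forall>q. heis_dist q p < \<delta> \<longrightarrow> T q \<subseteq> {v + b | v b. v \<in> T p \<and> b \<in> ball 0 \<epsilon>})"

definition sv_usc :: "('n::finite heis \<Rightarrow> 'n horiz set) \<Rightarrow> bool" where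
  "sv_usc T \<longleftrightarrow> (\<forall>p. sv_usc_at T p)"

end

theory Submission imports Defs begin

text \<open>
  Local boundedness yields a closed graph as follows. Let \<open>q\<^sub>k \<rightarrow> p\<close>, \<open>v\<^sub>k \<in> T q\<^sub>k\<close>, \<open>v\<^sub>k \<rightarrow> v\<close>, and
  let \<open>(p', v')\<close> be in the graph with \<open>p'\<close> in the horizontal plane of \<open>p\<close>. If \<open>p\<close> and \<open>p'\<close> have
  different horizontal parts, then the horizontal planes of \<open>q\<^sub>k\<close> and \<open>p'\<close> meet in points \<open>r\<^sub>k\<close>
  converging to the midpoint of the horizontal segment from \<open>p\<close> to \<open>p'\<close>. Monotonicity for the pairs
  \<open>q\<^sub>k, r\<^sub>k\<close> and \<open>r\<^sub>k, p'\<close>, with bounded values at \<open>r\<^sub>k\<close> that cancel in the limit, gives monotonicity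
  for \<open>(p, v)\<close> and \<open>(p', v')\<close>; maximality then forces \<open>v \<in> T p\<close>. A closed graph and local boundedness
  give upper semicontinuity by compactness. Conversely, upper semicontinuity gives local boundedness
  because each \<open>T p\<close> is bounded: monotonicity along a horizontal line through \<open>p\<close> bounds the values
  at \<open>p\<close> in the direction of that line.
\<close>

section \<open>Horizontal planes in terms of the symplectic form\<close>

text \<open>The standard symplectic rotation: \<open>horiz_rot a \<bullet> b\<close> is the
  antisymmetric form that twists the group law, so that membership in a horizontal plane becomes one
  affine equation.\<close>

definition horiz_rot :: "'n::finite horiz \<Rightarrow> 'n horiz" where
  "horiz_rot z = (snd z, - fst z)"

lemma xi1_eq: "xi1 p = (fst p, fst (snd p))"
  by (cases p) simp

lemma hplane_iff:
  "q \<in> hplane p \<longleftrightarrow> snd (snd q) = snd (snd p) + 2 * (horiz_rot (xi1 p) \<bullet> xi1 q)"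
  by (cases p; cases q) (auto simp: horiz_rot_def inner_prod_def)

lemma horiz_rot_diff: "horiz_rot (a - b) = horiz_rot a - horiz_rot b"
  by (simp add: horiz_rot_def)

lemma inner_horiz_rot_swap: "horiz_rot a \<bullet> b = - (horiz_rot b \<bullet> a)"
  by (simp add: horiz_rot_def inner_prod_def inner_commute)

lemma inner_horiz_rot_self [simp]: "horiz_rot a \<bullet> a = 0"
  using inner_horiz_rot_swap[of a a] by simp

lemma horiz_rot_eq_0_iff [simp]: "horiz_rot a = 0 \<longleftrightarrow> a = 0"
  by (cases a) (auto simp: horiz_rot_def zero_prod_def)

lemma tendsto_horiz_rot:
  "(f \<longlongrightarrow> a) F \<Longrightarrow> ((\<lambda>x. horiz_rot (f x)) \<longlongrightarrow> horiz_rot a) F"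
  unfolding horiz_rot_def by (intro tendsto_intros)

lemma tendsto_xi1:
  "(f \<longlongrightarrow> a) F \<Longrightarrow> ((\<lambda>x. xi1 (f x)) \<longlongrightarrow> xi1 a) F"
  unfolding xi1_eq by (intro tendsto_intros)

lemma hplane_sym: "q \<in> hplane p \<longleftrightarrow> p \<in> hplane q"
  using inner_horiz_rot_swap[of "xi1 p" "xi1 q"] by (auto simp: hplane_iff)

lemma hplane_lift:
  fixes p :: "'n::finite heis"
  shows "\<exists>q\<in>hplane p. xi1 q = z"
  by (rule bexI[of _ "(fst z, snd z, snd (snd p) + 2 * (horiz_rot (xi1 p) \<bullet> z))"])
    (auto simp: hplane_iff)

section \<open>The gauge and convergence in the Heisenberg distance\<close>

lemma heis_gauge_bounds:
  "norm (fst p) \<le> heis_gauge p" "norm (fst (snd p)) \<le> heis_gauge p"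
  "\<bar>snd (snd p)\<bar> \<le> (heis_gauge p)\<^sup>2"
proof -
  obtain x y t where p: "p = (x, y, t)" by (cases p)
  define g where "g = heis_gauge p"
  define s where "s = (norm x)\<^sup>2 + (norm y)\<^sup>2"
  have g4: "g ^ 4 = s\<^sup>2 + t\<^sup>2" and g0: "0 \<le> g"
    by (auto simp: g_def p s_def)
  have "s\<^sup>2 \<le> (g\<^sup>2)\<^sup>2" "\<bar>t\<bar>\<^sup>2 \<le> (g\<^sup>2)\<^sup>2"
    using g4 by simp_all
  then have s: "s \<le> g\<^sup>2" and t: "\<bar>t\<bar> \<le> g\<^sup>2"
    using power2_le_imp_le zero_le_power2 by blast+
  have "(norm x)\<^sup>2 \<le> g\<^sup>2" "(norm y)\<^sup>2 \<le> g\<^sup>2"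
    using s unfolding s_def by (smt (verit) zero_le_power2)+
  then have "norm x \<le> g" "norm y \<le> g"
    using g0 power2_le_imp_le by blast+
  then show "norm (fst p) \<le> heis_gauge p" "norm (fst (snd p)) \<le> heis_gauge p"
    "\<bar>snd (snd p)\<bar> \<le> (heis_gauge p)\<^sup>2"
    using t unfolding g_def by (simp_all add: p del: heis_gauge.simps)
qed

lemma heis_dist_eq:
  "heis_dist q p = heis_gauge (fst q - fst p, fst (snd q) - fst (snd p),
     snd (snd q) - snd (snd p) - 2 * (horiz_rot (xi1 p) \<bullet> xi1 q))"
  by (cases p; cases q)
    (simp add: heis_dist_def horiz_rot_def inner_prod_def inner_commute algebra_simps)

lemma heis_dist_self: "heis_dist p p = 0"
  by (simp add: heis_dist_eq)

lemma continuous_heis_dist: "continuous_on UNIV (\<lambda>q. heis_dist q p)"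
  unfolding heis_dist_eq xi1_eq heis_gauge.simps by (intro continuous_intros)

lemma heis_dist_tendsto_0_imp_tendsto:
  fixes q :: "'a \<Rightarrow> 'n::finite heis"
  assumes "((\<lambda>k. heis_dist (q k) p) \<longlongrightarrow> 0) F"
  shows "(q \<longlongrightarrow> p) F"
proof -
  let ?\<tau> = "\<lambda>k. snd (snd (q k)) - snd (snd p) - 2 * (horiz_rot (xi1 p) \<bullet> xi1 (q k))"
  note b = heis_gauge_bounds[of "(fst (q k) - fst p, fst (snd (q k)) - fst (snd p), ?\<tau> k)" for k,
      folded heis_dist_eq, simplified]
  have "((\<lambda>k. fst (q k) - fst p) \<longlongrightarrow> 0) F"
    by (rule Lim_null_comparison[OF _ assms]) (use b in auto)
  then have x: "((\<lambda>k. fst (q k)) \<longlongrightarrow> fst p) F" by (simp add: Lim_null[symmetric])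
  have "((\<lambda>k. fst (snd (q k)) - fst (snd p)) \<longlongrightarrow> 0) F"
    by (rule Lim_null_comparison[OF _ assms]) (use b in auto)
  then have y: "((\<lambda>k. fst (snd (q k))) \<longlongrightarrow> fst (snd p)) F" by (simp add: Lim_null[symmetric])
  have "((\<lambda>k. (heis_dist (q k) p)\<^sup>2) \<longlongrightarrow> 0) F"
    using tendsto_power[OF assms, of 2] by simp
  then have t: "(?\<tau> \<longlongrightarrow> 0) F"
    by (rule Lim_null_comparison[rotated]) (use b in auto)
  have xi: "((\<lambda>k. xi1 (q k)) \<longlongrightarrow> xi1 p) F"
    unfolding xi1_eq by (intro tendsto_intros x y)
  \<comment> \<open>Undoing the twist in the last coordinate: the added form tends to
    \<open>horiz_rot (xi1 p) \<bullet> xi1 p\<close>, which is 0 by antisymmetry.\<close>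
  have "((\<lambda>k. ?\<tau> k + snd (snd p) + 2 * (horiz_rot (xi1 p) \<bullet> xi1 (q k)))
      \<longlongrightarrow> 0 + snd (snd p) + 2 * (horiz_rot (xi1 p) \<bullet> xi1 p)) F"
    by (intro tendsto_intros t xi)
  then have h: "((\<lambda>k. snd (snd (q k))) \<longlongrightarrow> snd (snd p)) F" by simp
  have "((\<lambda>k. (fst (q k), fst (snd (q k)), snd (snd (q k))))
      \<longlongrightarrow> (fst p, fst (snd p), snd (snd p))) F"
    by (intro tendsto_Pair x y h)
  then show ?thesis by simp
qed

section \<open>Maximal H-monotone maps and boundedness of their values\<close>

lemma maximal_H_monotoneD:
  assumes "maximal_H_monotone T" "v \<in> T p" "w \<in> T q" "q \<in> hplane p"
  shows "(xi1 p - xi1 q) \<bullet> (v - w) \<ge> 0"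
  using assms
  unfolding maximal_H_monotone_def maximal_H_monotone_set_def H_monotone_set_def sv_graph_def
  by blast

text \<open>Otherwise adding \<open>(p, v)\<close> to the graph would give a strictly larger
  H-monotone set.\<close>

lemma maximal_H_monotoneI:
  fixes T :: "'n::finite heis \<Rightarrow> 'n horiz set"
  assumes "maximal_H_monotone T"
    and rel: "\<And>q w. q \<in> hplane p \<Longrightarrow> w \<in> T q \<Longrightarrow> (xi1 p - xi1 q) \<bullet> (v - w) \<ge> 0"
  shows "v \<in> T p"
proof (rule ccontr)
  assume "v \<notin> T p"
  let ?B = "insert (p, v) (sv_graph T)"
  have rel': "(xi1 q - xi1 p) \<bullet> (w - v) \<ge> 0" if "p \<in> hplane q" "w \<in> T q" for q w
  proof -
    have "(xi1 q - xi1 p) \<bullet> (w - v) = (xi1 p - xi1 q) \<bullet> (v - w)"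
      by (simp add: algebra_simps)
    then show ?thesis using rel[of q w] that by (simp add: hplane_sym[of p q])
  qed
  have "H_monotone_set ?B"
    using rel rel' maximal_H_monotoneD[OF assms(1)]
    unfolding H_monotone_set_def by (auto simp: sv_graph_def)
  moreover have "sv_graph T \<subset> ?B" using \<open>v \<notin> T p\<close> by (auto simp: sv_graph_def)
  ultimately show False
    using assms(1) unfolding maximal_H_monotone_def maximal_H_monotone_set_def by blast
qed

lemma bounded_values:
  fixes T :: "'n::finite heis \<Rightarrow> 'n horiz set"
  assumes max: "maximal_H_monotone T" and dom: "sv_dom T = UNIV"
  shows "bounded (T p)"
proof -
  have dir: "\<exists>c. \<forall>v\<in>T p. v \<bullet> u \<le> c" for u
  proof -
    obtain q where q: "q \<in> hplane p" "xi1 q = xi1 p + u" using hplane_lift by blast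
    obtain w where w: "w \<in> T q" using dom by (force simp: sv_dom_def)
    \<comment> \<open>The horizontal displacement from \<open>p\<close> to \<open>q\<close> is
      \<open>u\<close>, so one fixed value \<open>w\<close> at \<open>q\<close> bounds all of
      \<open>T p\<close> in direction \<open>u\<close>; using \<open>- u\<close> as well makes the
      bound two-sided.\<close>
    have "v \<bullet> u \<le> w \<bullet> u" if "v \<in> T p" for v
      using maximal_H_monotoneD[OF max that w q(1)] q(2)
      by (simp add: inner_commute inner_diff_left inner_diff_right)
    then show ?thesis by blast
  qed
  have "\<exists>c. \<forall>v\<in>T p. \<bar>v \<bullet> u\<bar> \<le> c" for u
  proof -
    obtain c1 c2 where "\<forall>v\<in>T p. v \<bullet> u \<le> c1" "\<forall>v\<in>T p. v \<bullet> (- u) \<le> c2"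
      using dir by meson
    then have "\<forall>v\<in>T p. \<bar>v \<bullet> u\<bar> \<le> max c1 c2"
      by (simp add: abs_le_iff) (meson le_max_iff_disj)
    then show ?thesis by blast
  qed
  then obtain c where c: "\<And>u v. v \<in> T p \<Longrightarrow> \<bar>v \<bullet> u\<bar> \<le> c u" by metis
  have "norm v \<le> (\<Sum>u\<in>Basis. c u)" if "v \<in> T p" for v
    by (rule order_trans[OF norm_le_l1 sum_mono]) (rule c[OF that])
  then show ?thesis unfolding bounded_iff by blast
qed

section \<open>Closedness of the graph\<close>

text \<open>Equating the heights of the planes of \<open>q k\<close> and \<open>p'\<close> over
  \<open>x\<close> gives the hyperplane \<open>a k \<bullet> x = b k\<close>. These hyperplanes
  converge to one with normal \<open>a0 \<noteq> 0\<close> that contains the midpoint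
  \<open>m\<close>, so the projections of \<open>m\<close> onto them converge to
  \<open>m\<close>.\<close>

lemma hplanes_meet_near_midpoint:
  fixes q :: "nat \<Rightarrow> 'n::finite heis"
  assumes q: "q \<longlonglongrightarrow> p" and p': "p' \<in> hplane p" and ne: "xi1 p \<noteq> xi1 p'"
  obtains r r0 where "r \<longlonglongrightarrow> r0" "xi1 r0 = (1/2) *\<^sub>R (xi1 p + xi1 p')"
    "\<And>k. r k \<in> hplane p'" "eventually (\<lambda>k. r k \<in> hplane (q k)) sequentially"
proof -
  define m where "m = (1/2) *\<^sub>R (xi1 p + xi1 p')"
  define a where "a k = horiz_rot (xi1 p' - xi1 (q k))" for k
  define b where "b k = (snd (snd (q k)) - snd (snd p')) / 2" for k
  \<comment> \<open>Orthogonal projection of \<open>m\<close> onto the hyperplane; where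
    \<open>a k = 0\<close> the quotient is 0 and \<open>z k = m\<close>, which can occur for only
    finitely many \<open>k\<close>.\<close>
  define z where "z k = m - ((a k \<bullet> m - b k) / (a k \<bullet> a k)) *\<^sub>R a k" for k
  define lift where "lift x = (fst x, snd x, snd (snd p') + 2 * (horiz_rot (xi1 p') \<bullet> x))"
    for x :: "'n horiz"
  define a0 where "a0 = horiz_rot (xi1 p' - xi1 p)"
  define b0 where "b0 = (snd (snd p) - snd (snd p')) / 2"
  have a: "a \<longlonglongrightarrow> a0"
    unfolding a_def a0_def by (intro tendsto_horiz_rot tendsto_intros tendsto_xi1 q)
  have b: "b \<longlonglongrightarrow> b0"
    unfolding b_def b0_def by (intro tendsto_intros q) simp
  have a0: "a0 \<noteq> 0" using ne by (simp add: a0_def)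
  have ab0: "a0 \<bullet> m = b0"
    using p' inner_horiz_rot_swap[of "xi1 p'" "xi1 p"]
    by (simp add: a0_def b0_def m_def hplane_iff horiz_rot_diff inner_diff_left inner_add_right)
  have "z \<longlonglongrightarrow> m - ((a0 \<bullet> m - b0) / (a0 \<bullet> a0)) *\<^sub>R a0"
    unfolding z_def by (intro tendsto_intros a b) (use a0 in simp)
  then have z: "z \<longlonglongrightarrow> m" by (simp add: ab0)
  have "(\<lambda>k. lift (z k)) \<longlonglongrightarrow> lift m"
    unfolding lift_def by (intro tendsto_intros z)
  moreover have xi_lift: "xi1 (lift x) = x" for x by (simp add: lift_def)
  moreover have "lift x \<in> hplane p'" for x by (simp add: hplane_iff xi_lift) (simp add: lift_def)
  moreover have "eventually (\<lambda>k. lift (z k) \<in> hplane (q k)) sequentially"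
    using tendsto_imp_eventually_ne[OF a a0]
  proof eventually_elim
    case (elim k)
    have "a k \<bullet> z k = b k"
      using elim by (simp add: z_def inner_diff_right)
    then show ?case
      unfolding hplane_iff xi_lift
      by (simp add: lift_def a_def b_def horiz_rot_diff inner_diff_left)
  qed
  ultimately show thesis using that[of "\<lambda>k. lift (z k)" "lift m"] by (simp add: m_def)
qed

lemma locally_bounded_imp_closed_graph:
  fixes T :: "'n::finite heis \<Rightarrow> 'n horiz set"
  assumes max: "maximal_H_monotone T" and dom: "sv_dom T = UNIV"
    and lb: "sv_locally_bounded T"
    and q: "q \<longlonglongrightarrow> p" and vT: "\<And>k. v k \<in> T (q k)" and v: "v \<longlonglongrightarrow> v0"
  shows "v0 \<in> T p"
proof (rule maximal_H_monotoneI[OF max])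
  fix p' v' assume p': "p' \<in> hplane p" and v': "v' \<in> T p'"
  show "(xi1 p - xi1 p') \<bullet> (v0 - v') \<ge> 0"
  proof (cases "xi1 p = xi1 p'")
    case False
    obtain r r0 where r: "r \<longlonglongrightarrow> r0" and r0: "xi1 r0 = (1/2) *\<^sub>R (xi1 p + xi1 p')"
      and rp': "\<And>k. r k \<in> hplane p'"
      and rq: "eventually (\<lambda>k. r k \<in> hplane (q k)) sequentially"
      using hplanes_meet_near_midpoint[OF q p' False] by blast
    have "\<forall>k. \<exists>w. w \<in> T (r k)" using dom by (force simp: sv_dom_def)
    then obtain w where w: "\<And>k. w k \<in> T (r k)" by metis
    obtain U where U: "open U" "r0 \<in> U" "bounded (\<Union>x\<in>U. T x)"
      using lb unfolding sv_locally_bounded_def by blast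
    then obtain B where B: "\<And>x y. x \<in> U \<Longrightarrow> y \<in> T x \<Longrightarrow> norm y \<le> B"
      unfolding bounded_iff by blast
    have "eventually (\<lambda>k. r k \<in> U) sequentially" using topological_tendstoD[OF r U(1,2)] .
    \<comment> \<open>The values \<open>w k\<close> need not converge; boundedness suffices because
      their coefficient tends to 0, the horizontal part of \<open>r0\<close> being the
      midpoint.\<close>
    then have wB: "Bfun w sequentially"
      by (intro BfunI[of _ B]) (auto elim!: eventually_mono intro: B w)
    have "(\<lambda>k. xi1 (q k) - xi1 (r k) - (xi1 (r k) - xi1 p'))
        \<longlonglongrightarrow> xi1 p - xi1 r0 - (xi1 r0 - xi1 p')"
      by (intro tendsto_intros tendsto_xi1 q r)
    also have "xi1 p - xi1 r0 - (xi1 r0 - xi1 p') = 0"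
      unfolding r0 by (simp add: algebra_simps flip: scaleR_add_left)
    finally have "(\<lambda>k. (xi1 (q k) - xi1 (r k) - (xi1 (r k) - xi1 p')) \<bullet> w k) \<longlonglongrightarrow> 0"
      using bounded_bilinear.Zfun_prod_Bfun[OF bounded_bilinear_inner _ wB]
      by (simp add: tendsto_Zfun_iff)
    moreover have "(\<lambda>k. (xi1 (q k) - xi1 (r k)) \<bullet> v k - (xi1 (r k) - xi1 p') \<bullet> v')
        \<longlonglongrightarrow> (xi1 p - xi1 r0) \<bullet> v0 - (xi1 r0 - xi1 p') \<bullet> v'"
      by (intro tendsto_intros tendsto_xi1 q r v)
    \<comment> \<open>The sum of the two monotonicity inequalities, with all terms in
      \<open>w k\<close> moved to the left.\<close>
    moreover have "eventually (\<lambda>k. (xi1 (q k) - xi1 (r k) - (xi1 (r k) - xi1 p')) \<bullet> w k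
        \<le> (xi1 (q k) - xi1 (r k)) \<bullet> v k - (xi1 (r k) - xi1 p') \<bullet> v') sequentially"
      using rq
    proof eventually_elim
      case (elim k)
      have "p' \<in> hplane (r k)" using rp' hplane_sym by blast
      from maximal_H_monotoneD[OF max vT w elim] maximal_H_monotoneD[OF max w v' this]
      show ?case by (simp add: inner_diff_left inner_diff_right)
    qed
    ultimately have "0 \<le> (xi1 p - xi1 r0) \<bullet> v0 - (xi1 r0 - xi1 p') \<bullet> v'"
      by (intro tendsto_le[OF sequentially_bot])
    also have "(xi1 p - xi1 r0) \<bullet> v0 - (xi1 r0 - xi1 p') \<bullet> v'
        = (1/2) * ((xi1 p - xi1 p') \<bullet> (v0 - v'))"
      unfolding r0 by (simp add: inner_diff_left inner_diff_right inner_add_left algebra_simps)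
    finally show ?thesis by simp
  qed simp
qed

section \<open>The two implications between local boundedness and upper semicontinuity\<close>

lemma locally_bounded_imp_usc:
  fixes T :: "'n::finite heis \<Rightarrow> 'n horiz set"
  assumes max: "maximal_H_monotone T" and dom: "sv_dom T = UNIV"
    and lb: "sv_locally_bounded T"
  shows "sv_usc_at T p"
proof (rule ccontr)
  assume "\<not> sv_usc_at T p"
  then obtain e where e: "e > 0"
    and far: "\<And>d. d > 0 \<Longrightarrow>
      \<exists>q. heis_dist q p < d \<and> \<not> T q \<subseteq> {v + b | v b. v \<in> T p \<and> b \<in> ball 0 e}"
    unfolding sv_usc_at_def by blast
  define S where "S = {v + b | v b. v \<in> T p \<and> b \<in> ball 0 e}"
  have "\<exists>q v. heis_dist q p < 1 / real (Suc k) \<and> v \<in> T q \<and> v \<notin> S" for k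
  proof -
    have "1 / real (Suc k) > 0" by simp
    from far[OF this] show ?thesis unfolding S_def by blast
  qed
  then obtain q v where qd: "\<And>k. heis_dist (q k) p < 1 / real (Suc k)"
    and v: "\<And>k. v k \<in> T (q k)" and nv: "\<And>k. v k \<notin> S"
    by metis
  have gauge_nonneg: "0 \<le> heis_dist (q k) p" for k
    unfolding heis_dist_eq by simp
  have "(\<lambda>k. heis_dist (q k) p) \<longlonglongrightarrow> 0"
  proof (rule Lim_null_comparison[OF always_eventually lim_1_over_n[THEN LIMSEQ_Suc]], rule allI)
    show "norm (heis_dist (q k) p) \<le> 1 / real (Suc k)" for k
      using qd[of k] gauge_nonneg[of k] by simp
  qed
  then have q: "q \<longlonglongrightarrow> p" by (rule heis_dist_tendsto_0_imp_tendsto)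
  obtain U where U: "open U" "p \<in> U" "bounded (\<Union>x\<in>U. T x)"
    using lb unfolding sv_locally_bounded_def by blast
  obtain N where N: "\<And>k. k \<ge> N \<Longrightarrow> q k \<in> U"
    using topological_tendstoD[OF q U(1,2)] unfolding eventually_sequentially by blast
  \<comment> \<open>Dropping the first \<open>N\<close> terms puts every value in the bounded set
    \<open>T(U)\<close>, so a subsequence converges; its limit lies in \<open>T p\<close>,
    contradicting that all \<open>v k\<close> avoid the \<open>e\<close>-neighbourhood
    \<open>S\<close> of \<open>T p\<close>.\<close>
  have "bounded (range (\<lambda>k. v (k + N)))"
    by (rule bounded_subset[OF U(3)]) (use N[OF le_add2] v in blast)
  then obtain v0 s where s: "strict_mono s" and v0: "((\<lambda>k. v (k + N)) \<circ> s) \<longlonglongrightarrow> v0"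
    using bounded_imp_convergent_subsequence by blast
  have "(\<lambda>k. q (k + N)) \<longlonglongrightarrow> p" using q by (rule LIMSEQ_ignore_initial_segment)
  then have qs: "((\<lambda>k. q (k + N)) \<circ> s) \<longlonglongrightarrow> p" using s by (rule LIMSEQ_subseq_LIMSEQ)
  have "v0 \<in> T p"
    by (rule locally_bounded_imp_closed_graph[OF max dom lb qs _ v0]) (simp add: v)
  moreover obtain k where "dist (v (s k + N)) v0 < e"
    using tendstoD[OF v0 e] unfolding eventually_sequentially by auto
  moreover have "v (s k + N) = v0 + (v (s k + N) - v0)" by simp
  ultimately have "v (s k + N) \<in> S"
    unfolding S_def mem_ball_0 dist_norm by blast
  then show False using nv by blast
qed

lemma usc_imp_locally_bounded:
  fixes T :: "'n::finite heis \<Rightarrow> 'n horiz set"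
  assumes max: "maximal_H_monotone T" and dom: "sv_dom T = UNIV" and usc: "sv_usc T"
  shows "sv_locally_bounded T"
  unfolding sv_locally_bounded_def
proof
  fix p
  obtain d where d: "d > 0"
    "\<And>q. heis_dist q p < d \<Longrightarrow> T q \<subseteq> {v + b | v b. v \<in> T p \<and> b \<in> ball 0 1}"
    using usc unfolding sv_usc_def sv_usc_at_def by (meson zero_less_one)
  let ?U = "{q. heis_dist q p < d}"
  have "open ?U"
    by (rule open_Collect_less[OF continuous_heis_dist continuous_on_const])
  moreover have "p \<in> ?U" using d(1) by (simp add: heis_dist_self)
  \<comment> \<open>Radius 1 is arbitrary: any fixed enlargement of the bounded set
    \<open>T p\<close> stays bounded.\<close>
  moreover have "bounded {v + b | v b. v \<in> T p \<and> b \<in> ball 0 1}"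
    by (rule bounded_subset[OF bounded_plus[OF bounded_values[OF max dom, of p] bounded_ball[of 0 1]]])
      force
  then have "bounded (\<Union>q\<in>?U. T q)"
    by (rule bounded_subset) (use d(2) in blast)
  ultimately show "\<exists>U. open U \<and> p \<in> U \<and> bounded (\<Union>q\<in>U. T q)" by blast
qed

theorem theorem2p2:
  fixes T :: "'n::finite heis \<Rightarrow> 'n horiz set"
  assumes "maximal_H_monotone T"
    and "sv_dom T = UNIV"
  shows "sv_locally_bounded T \<longleftrightarrow> sv_usc T"
  using locally_bounded_imp_usc[OF assms] usc_imp_locally_bounded[OF assms]
  unfolding sv_usc_def by blast

end
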